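(* There is a universal constant $C>0$ such that, for every $d\in\mathbb N$, $R>0$, $0<\mu\le\beta$, and $0<\epsilon\le\beta R^2$, writing $Q=\beta R^2/\epsilon$ and $\kappa=\beta/\mu$, $$N_\epsilon(d,R,\mu,\beta)\le C\,d\,\min\left\{\sqrt Q,\ \sqrt\kappa\left[1+\log_+(Q/\kappa)\right]\right\}.$$ Moreover, this bound is achieved by deterministic adaptive algorithms all of whose queries lie in $X=B_2^d(R)$ and whose outputs lie in $B_2^d(R/2)$.
   Context: $B_2^d(r)$ is the closed Euclidean ball of radius $r$ centred at $0$ in $\mathbb R^d$; $X:=B_2^d(R)$. $\log_+(u):=\max\{0,\log u\}$ for $u>0$. Class $\mathcal F_{\mu,\beta}(d,R)$: all continuously differentiable $f:\mathbb R^d\to\mathbb R$ such that for all $x,y\in\mathbb R^d$, $f(y)\ge f(x)+\langle\nabla f(x),y-x\rangle+\frac\mu2\|y-x\|_2^2$ and $\|\nabla f(x)-\nabla f(y)\|_2\le\beta\|x-y\|_2$, and whose unique minimizer $x_f^\star$ lies in $B_2^d(R/2)$. Write $f^\star=f(x_f^\star)$. A deterministic adaptive algorithm with budget $T$ (a $T$-call algorithm) consists of Borel maps $Q_t:(X\times\mathbb R)^{t-1}\to X$, $t=1,\dots,T$, and a Borel terminal map $Q_{\mathrm{out}}:(X\times\mathbb R)^T\to X$. On a fixed objective $f$ it generates recursively $x_t=Q_t((x_1,f(x_1)),\dots,(x_{t-1},f(x_{t-1})))$ and outputs $\widehat x_f=Q_{\mathrm{out}}((x_1,f(x_1)),\dots,(x_T,f(x_T)))$.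 Minimax exact-value complexity: $N_\epsilon(d,R,\mu,\beta)$ is the infimum of all $T\in\mathbb N_0$ for which there exists a deterministic adaptive $T$-call algorithm with $\sup_{f\in\mathcal F_{\mu,\beta}(d,R)}[f(\widehat x_f)-f^\star]\le\epsilon$ (with $\inf\varnothing=+\infty$). *)

theory Defs
  imports "HOL-Analysis.Analysis"
begin

text \<open>
  The constant of the theorem is uniform in the dimension, so the dimension must be a term:
  points of \<open>\<real>\<^sup>d\<close> are the elements of \<^term>\<open>topspace (Euclidean_space d)\<close>,
  i.e. the real sequences that vanish from index \<open>d\<close> on. The values of an objective
  outside this set are never used.
\<close>

definition edot :: "nat \<Rightarrow> (nat \<Rightarrow> real) \<Rightarrow> (nat \<Rightarrow> real) \<Rightarrow> real" where
  "edot d x y = (\<Sum>i<d. x i * y i)"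

definition enorm :: "nat \<Rightarrow> (nat \<Rightarrow> real) \<Rightarrow> real" where
  "enorm d x = L2_set x {..<d}"

definition euclid_cball :: "nat \<Rightarrow> real \<Rightarrow> (nat \<Rightarrow> real) set" where
  "euclid_cball d r = {x \<in> topspace (Euclidean_space d). enorm d x \<le> r}"

text \<open>Frechet differentiability on \<open>\<real>\<^sup>d\<close> (spelled out because sequences do not form
  a normed space); the gradient represents the derivative.\<close>

definition has_gradient ::
  "nat \<Rightarrow> ((nat \<Rightarrow> real) \<Rightarrow> real) \<Rightarrow> (nat \<Rightarrow> real) \<Rightarrow> (nat \<Rightarrow> real) \<Rightarrow> bool" where
  "has_gradient d f x g \<longleftrightarrow>
     (\<forall>e>0. \<exists>\<delta>>0. \<forall>y\<in>topspace (Euclidean_space d). enorm d (\<lambda>i. y i - x i) < \<delta> \<longrightarrow>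
        \<bar>f y - f x - edot d g (\<lambda>i. y i - x i)\<bar> \<le> e * enorm d (\<lambda>i. y i - x i))"

definition gradient ::
  "nat \<Rightarrow> ((nat \<Rightarrow> real) \<Rightarrow> real) \<Rightarrow> (nat \<Rightarrow> real) \<Rightarrow> (nat \<Rightarrow> real)" where
  "gradient d f x = (THE g. g \<in> topspace (Euclidean_space d) \<and> has_gradient d f x g)"

definition continuously_differentiable :: "nat \<Rightarrow> ((nat \<Rightarrow> real) \<Rightarrow> real) \<Rightarrow> bool" where
  "continuously_differentiable d f \<longleftrightarrow>
     (\<forall>x\<in>topspace (Euclidean_space d). \<exists>g\<in>topspace (Euclidean_space d). has_gradient d f x g) \<and>
     continuous_map (Euclidean_space d) (Euclidean_space d) (gradient d f)"

definition is_minimizer :: "nat \<Rightarrow> ((nat \<Rightarrow> real) \<Rightarrow> real) \<Rightarrow> (nat \<Rightarrow> real) \<Rightarrow> bool" where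
  "is_minimizer d f x \<longleftrightarrow>
     x \<in> topspace (Euclidean_space d) \<and> (\<forall>y\<in>topspace (Euclidean_space d). f x \<le> f y)"

definition minimizer :: "nat \<Rightarrow> ((nat \<Rightarrow> real) \<Rightarrow> real) \<Rightarrow> (nat \<Rightarrow> real)" where
  "minimizer d f = (THE x. is_minimizer d f x)"

definition objective_class ::
  "nat \<Rightarrow> real \<Rightarrow> real \<Rightarrow> real \<Rightarrow> ((nat \<Rightarrow> real) \<Rightarrow> real) set" where
  "objective_class d R \<mu> \<beta> =
     {f. continuously_differentiable d f \<and>
         (\<forall>x\<in>topspace (Euclidean_space d). \<forall>y\<in>topspace (Euclidean_space d).
            f y \<ge> f x + edot d (gradient d f x) (\<lambda>i. y i - x i)
                   + \<mu> / 2 * (enorm d (\<lambda>i. y i - x i))\<^sup>2 \<and>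
            enorm d (\<lambda>i. gradient d f x i - gradient d f y i)
              \<le> \<beta> * enorm d (\<lambda>i. x i - y i)) \<and>
         (\<exists>!x. is_minimizer d f x) \<and>
         minimizer d f \<in> euclid_cball d (R / 2)}"

text \<open>The topology of \<^term>\<open>Euclidean_space d\<close> is inherited from the product topology on
  \<^typ>\<open>nat \<Rightarrow> real\<close>, so \<open>query_space\<close> is the ball \<open>X\<close> with its usual Borel sets. All spaces
  involved are second countable, hence the product sigma-algebra in \<open>history_space\<close> is the Borel
  sigma-algebra of \<open>(X \<times> \<real>)\<^sup>t\<close>.\<close>

definition query_space :: "nat \<Rightarrow> real \<Rightarrow> (nat \<Rightarrow> real) measure" where
  "query_space d R = restrict_space borel (euclid_cball d R)"

definition history_space :: "nat \<Rightarrow> real \<Rightarrow> nat \<Rightarrow> (nat \<Rightarrow> (nat \<Rightarrow> real) \<times> real) measure" where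
  "history_space d R t = (\<Pi>\<^sub>M i\<in>{..<t}. query_space d R \<Otimes>\<^sub>M (borel :: real measure))"

text \<open>Queries are numbered from 0: \<open>q t\<close> makes its choice from the \<open>t\<close> preceding pairs.
  Measurability includes that queries and outputs lie in \<^term>\<open>euclid_cball d R\<close>.\<close>

definition is_algorithm :: "nat \<Rightarrow> real \<Rightarrow> nat \<Rightarrow>
    (nat \<Rightarrow> (nat \<Rightarrow> (nat \<Rightarrow> real) \<times> real) \<Rightarrow> (nat \<Rightarrow> real)) \<Rightarrow>
    ((nat \<Rightarrow> (nat \<Rightarrow> real) \<times> real) \<Rightarrow> (nat \<Rightarrow> real)) \<Rightarrow> bool" where
  "is_algorithm d R T q qout \<longleftrightarrow>
     (\<forall>t<T. q t \<in> measurable (history_space d R t) (query_space d R)) \<and>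
     qout \<in> measurable (history_space d R T) (query_space d R)"

text \<open>Entries of a transcript beyond its length are \<^term>\<open>undefined\<close>, as required for membership
  in the extensional product \<^term>\<open>space (history_space d R t)\<close>.\<close>

primrec transcript ::
  "(nat \<Rightarrow> (nat \<Rightarrow> (nat \<Rightarrow> real) \<times> real) \<Rightarrow> (nat \<Rightarrow> real)) \<Rightarrow>
   ((nat \<Rightarrow> real) \<Rightarrow> real) \<Rightarrow> nat \<Rightarrow> (nat \<Rightarrow> (nat \<Rightarrow> real) \<times> real)" where
  "transcript q f 0 = (\<lambda>_. undefined)"
| "transcript q f (Suc t) =
     (let x = q t (transcript q f t) in (transcript q f t)(t := (x, f x)))"

definition worst_gap :: "nat \<Rightarrow> real \<Rightarrow> real \<Rightarrow> real \<Rightarrow> nat \<Rightarrow>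
    (nat \<Rightarrow> (nat \<Rightarrow> (nat \<Rightarrow> real) \<times> real) \<Rightarrow> (nat \<Rightarrow> real)) \<Rightarrow>
    ((nat \<Rightarrow> (nat \<Rightarrow> real) \<times> real) \<Rightarrow> (nat \<Rightarrow> real)) \<Rightarrow> ereal" where
  "worst_gap d R \<mu> \<beta> T q qout =
     (SUP f\<in>objective_class d R \<mu> \<beta>. ereal (f (qout (transcript q f T)) - f (minimizer d f)))"

definition complexity :: "real \<Rightarrow> nat \<Rightarrow> real \<Rightarrow> real \<Rightarrow> real \<Rightarrow> enat" where
  "complexity \<epsilon> d R \<mu> \<beta> =
     (INF T\<in>{T. \<exists>q qout. is_algorithm d R T q qout \<and> worst_gap d R \<mu> \<beta> T q qout \<le> ereal \<epsilon>}. enat T)"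

definition log_plus :: "real \<Rightarrow> real" where
  "log_plus u = max 0 (ln u)"

end

theory Submission
  imports Defs
begin

text \<open>
  Exact function values give, with \<open>d + 1\<close> queries, a forward-difference gradient whose error is
  as small as desired, since the increment \<open>h\<close> may depend on every parameter. These gradients
  drive the projected accelerated method
  \<open>y = (1 - \<theta>) x + \<theta> z\<close>, \<open>z' = proj (z - g / (2 \<beta> \<theta>))\<close>, \<open>x' = (1 - \<theta>) x + \<theta> z'\<close>, which
  extrapolates by convex combinations only and so never leaves the ball of radius \<open>R / 2\<close>; the
  perturbed points stay in the ball of radius \<open>R\<close>. A stage of \<open>n\<close> steps started at distance \<open>D\<close>
  from the minimizer ends with a gap of at most \<open>4 \<beta> D\<^sup>2 / n\<^sup>2\<close>, up to the gradient error. One stage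
  with \<open>n\<close> of order \<open>sqrt Q\<close> yields the first term of the minimum. For the second, with \<open>n\<close> of order
  \<open>sqrt \<kappa>\<close>, strong convexity makes each stage halve the distance, and about
  \<open>1 + log\<^sub>+ (Q / \<kappa>)\<close> stages suffice.
\<close>

subsection \<open>Euclidean geometry on sequences\<close>

lemma enorm_sq: "(enorm d x)\<^sup>2 = (\<Sum>i<d. (x i)\<^sup>2)"
  by (simp add: enorm_def L2_set_def sum_nonneg)

lemma enorm_nonneg: "0 \<le> enorm d x"
  by (simp add: enorm_def)

lemma edot_le_enorm: "edot d x y \<le> enorm d x * enorm d y"
proof -
  have "edot d x y \<le> (\<Sum>i<d. \<bar>x i\<bar> * \<bar>y i\<bar>)"
    unfolding edot_def by (intro sum_mono) (metis abs_ge_self abs_mult)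
  also have "\<dots> \<le> enorm d x * enorm d y"
    unfolding enorm_def by (rule L2_set_mult_ineq)
  finally show ?thesis .
qed

lemma enorm_scale: "enorm d (\<lambda>i. c * x i) = \<bar>c\<bar> * enorm d x"
  by (simp add: enorm_def L2_set_def power_mult_distrib sum_distrib_left [symmetric] real_sqrt_mult)

lemma enorm_triangle: "enorm d (\<lambda>i. x i + y i) \<le> enorm d x + enorm d y"
  unfolding enorm_def by (rule L2_set_triangle_ineq)

lemma enorm_diff_le: "enorm d (\<lambda>i. x i - y i) \<le> enorm d x + enorm d y"
  using enorm_triangle[of d x "\<lambda>i. (-1) * y i"] by (simp only: enorm_scale) simp

lemma abs_component_le_enorm: "i < d \<Longrightarrow> \<bar>x i\<bar> \<le> enorm d x"
  unfolding enorm_def using member_le_L2_set[of "{..<d}" i "\<lambda>i. \<bar>x i\<bar>"]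
  by (simp add: L2_set_def)

lemma enorm_single: "enorm d (\<lambda>i. if i = j then c else 0) \<le> \<bar>c\<bar>"
proof -
  have "(\<Sum>i<d. (if i = j then c else 0)\<^sup>2) = (\<Sum>i<d. if i = j then c\<^sup>2 else 0)"
    by (intro sum.cong) auto
  also have "\<dots> \<le> c\<^sup>2" by (simp add: sum.delta)
  finally show ?thesis
    by (simp add: enorm_def L2_set_def) (metis real_sqrt_abs real_sqrt_le_mono)
qed

lemma euclid_cball_iff:
  "x \<in> euclid_cball d r \<longleftrightarrow> (\<forall>i\<ge>d. x i = 0) \<and> enorm d x \<le> r"
  by (auto simp: euclid_cball_def topspace_Euclidean_space)

lemma euclid_cball_convex:
  assumes "x \<in> euclid_cball d r" "y \<in> euclid_cball d r" "0 \<le> t" "t \<le> 1"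
  shows "(\<lambda>i. (1 - t) * x i + t * y i) \<in> euclid_cball d r"
proof -
  have "enorm d (\<lambda>i. (1 - t) * x i + t * y i) \<le> (1 - t) * enorm d x + t * enorm d y"
    using enorm_triangle[of d "\<lambda>i. (1 - t) * x i" "\<lambda>i. t * y i"] assms
    by (simp add: enorm_scale)
  also have "\<dots> \<le> (1 - t) * r + t * r"
    using assms by (intro add_mono mult_left_mono) (auto simp: euclid_cball_iff)
  finally show ?thesis using assms by (auto simp: euclid_cball_iff algebra_simps)
qed

text \<open>Metric projection onto the centred ball of radius \<open>r\<close>, by radial scaling.
  The \<open>max\<close> treats points inside and outside in one formula, which keeps measurability
  immediate.\<close>

definition ball_proj :: "nat \<Rightarrow> real \<Rightarrow> (nat \<Rightarrow> real) \<Rightarrow> (nat \<Rightarrow> real)" where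
  "ball_proj d r u = (\<lambda>i. u i / max 1 (enorm d u / r))"

lemma ball_proj_in:
  assumes "r > 0" "\<forall>i\<ge>d. u i = 0"
  shows "ball_proj d r u \<in> euclid_cball d r"
proof -
  let ?m = "max 1 (enorm d u / r)"
  have "ball_proj d r u = (\<lambda>i. (1 / ?m) * u i)"
    by (simp add: ball_proj_def)
  then have "enorm d (ball_proj d r u) = enorm d u / ?m"
    by (simp only: enorm_scale) simp
  moreover have "enorm d u \<le> r * ?m"
    using assms by (auto simp: max_def field_simps)
  ultimately show ?thesis
    using assms by (auto simp: euclid_cball_iff ball_proj_def divide_le_eq)
qed

text \<open>The obtuse-angle property of a projection. Outside the ball the inner product factors as
  \<open>(1 - c) * (c * (enorm d u)\<^sup>2 - edot d u x)\<close> with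
  \<open>c = r / enorm d u\<close>, and Cauchy-Schwarz makes the second factor nonnegative.\<close>

lemma ball_proj_variational:
  assumes "r > 0" "x \<in> euclid_cball d r"
  shows "0 \<le> edot d (\<lambda>i. ball_proj d r u i - u i) (\<lambda>i. x i - ball_proj d r u i)"
proof (cases "enorm d u \<le> r")
  case True
  then have "max 1 (enorm d u / r) = 1" using assms by (simp add: max_def)
  then show ?thesis by (simp add: ball_proj_def edot_def)
next
  case False
  define c where "c = r / enorm d u"
  have pos: "enorm d u > 0" using False assms by linarith
  have c: "0 < c" "c < 1" using False assms pos by (auto simp: c_def)
  have p: "ball_proj d r u = (\<lambda>i. c * u i)"
    using False assms by (auto simp: ball_proj_def c_def max_def field_simps)
  have "edot d u x \<le> enorm d u * r"
    using edot_le_enorm[of d u x] assms pos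
    by (smt (verit) euclid_cball_iff mult_left_mono)
  also have "\<dots> = c * (enorm d u)\<^sup>2" using pos by (simp add: c_def power2_eq_square)
  finally have "0 \<le> (1 - c) * (c * (enorm d u)\<^sup>2 - edot d u x)" using c by simp
  also have "\<dots> = edot d (\<lambda>i. ball_proj d r u i - u i) (\<lambda>i. x i - ball_proj d r u i)"
    unfolding p edot_def enorm_sq
    by (simp add: sum_distrib_left sum_subtractf [symmetric] algebra_simps power2_eq_square)
  finally show ?thesis .
qed

text \<open>Polarization. It turns the projection inequality into differences of squared distances,
  which telescope over the steps of a stage.\<close>

lemma edot_three_points:
  "edot d (\<lambda>i. p i - z i) (\<lambda>i. x i - p i) =
    ((enorm d (\<lambda>i. z i - x i))\<^sup>2 - (enorm d (\<lambda>i. p i - x i))\<^sup>2 - (enorm d (\<lambda>i. p i - z i))\<^sup>2) / 2"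
  unfolding enorm_sq edot_def sum_subtractf [symmetric] sum_divide_distrib
  by (intro sum.cong) (auto simp: power2_eq_square field_simps)

subsection \<open>First-order inequalities\<close>

text \<open>The gradient is an abstract map \<open>G\<close>, reached through the two inequalities
  of the class; it is later instantiated with \<open>gradient d f\<close>.\<close>

locale smooth_convex =
  fixes d :: nat and \<mu> \<beta> :: real and f :: "(nat \<Rightarrow> real) \<Rightarrow> real"
    and G :: "(nat \<Rightarrow> real) \<Rightarrow> (nat \<Rightarrow> real)" and xopt :: "nat \<Rightarrow> real"
  assumes mu_pos: "\<mu> > 0" and beta_pos: "\<beta> > 0"
    and lower: "\<And>x y. x \<in> topspace (Euclidean_space d) \<Longrightarrow> y \<in> topspace (Euclidean_space d) \<Longrightarrow>
        f x + edot d (G x) (\<lambda>i. y i - x i) + \<mu> / 2 * (enorm d (\<lambda>i. y i - x i))\<^sup>2 \<le> f y"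
    and lipschitz: "\<And>x y. x \<in> topspace (Euclidean_space d) \<Longrightarrow> y \<in> topspace (Euclidean_space d) \<Longrightarrow>
        enorm d (\<lambda>i. G x i - G y i) \<le> \<beta> * enorm d (\<lambda>i. x i - y i)"
    and opt: "is_minimizer d f xopt"
begin

lemma xopt_in: "xopt \<in> topspace (Euclidean_space d)"
  using opt by (simp add: is_minimizer_def)

lemma gap_nonneg: "x \<in> topspace (Euclidean_space d) \<Longrightarrow> 0 \<le> f x - f xopt"
  using opt by (simp add: is_minimizer_def)

lemma tangent:
  assumes "x \<in> topspace (Euclidean_space d)" "y \<in> topspace (Euclidean_space d)"
  shows "f x + edot d (G x) (\<lambda>i. y i - x i) \<le> f y"
proof -
  have "0 \<le> \<mu> / 2 * (enorm d (\<lambda>i. y i - x i))\<^sup>2" using mu_pos by simp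
  then show ?thesis using lower[OF assms] by linarith
qed

text \<open>The tangent inequality at \<open>y\<close> replaces the integral of the gradient along a segment, at the
  price of the constant \<open>\<beta>\<close> in place of \<open>\<beta> / 2\<close>.\<close>

lemma upper:
  assumes "x \<in> topspace (Euclidean_space d)" "y \<in> topspace (Euclidean_space d)"
  shows "f y \<le> f x + edot d (G x) (\<lambda>i. y i - x i) + \<beta> * (enorm d (\<lambda>i. y i - x i))\<^sup>2"
proof -
  have "edot d (G y) (\<lambda>i. x i - y i) =
      - edot d (G x) (\<lambda>i. y i - x i) - edot d (\<lambda>i. G y i - G x i) (\<lambda>i. y i - x i)"
    unfolding edot_def sum_negf [symmetric] sum_subtractf [symmetric]
    by (intro sum.cong) (auto simp: algebra_simps)
  moreover have "edot d (\<lambda>i. G y i - G x i) (\<lambda>i. y i - x i)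
      \<le> \<beta> * enorm d (\<lambda>i. y i - x i) * enorm d (\<lambda>i. y i - x i)"
    using edot_le_enorm lipschitz[OF assms(2,1)]
    by (meson enorm_nonneg mult_right_mono order_trans)
  ultimately show ?thesis using tangent[OF assms(2,1)] by (simp add: power2_eq_square)
qed

text \<open>Strong convexity at the midpoint of \<open>x\<close> and \<open>xopt\<close> avoids showing that the gradient
  vanishes at \<open>xopt\<close>.\<close>

lemma quadratic_growth:
  assumes x: "x \<in> topspace (Euclidean_space d)"
  shows "\<mu> / 4 * (enorm d (\<lambda>i. x i - xopt i))\<^sup>2 \<le> f x - f xopt"
proof -
  define m where "m = (\<lambda>i. (x i + xopt i) / 2)"
  have m: "m \<in> topspace (Euclidean_space d)"
    using x xopt_in by (auto simp: m_def topspace_Euclidean_space)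
  have e: "(enorm d (\<lambda>i. x i - m i))\<^sup>2 = (enorm d (\<lambda>i. x i - xopt i))\<^sup>2 / 4"
    "(enorm d (\<lambda>i. xopt i - m i))\<^sup>2 = (enorm d (\<lambda>i. x i - xopt i))\<^sup>2 / 4"
    unfolding enorm_sq sum_divide_distrib m_def
    by (intro sum.cong; simp add: power2_eq_square field_simps)+
  \<comment> \<open>The displacements from the midpoint to its two ends are opposite, so the
    gradient terms cancel when the two strong convexity inequalities are added.\<close>
  have g: "edot d (G m) (\<lambda>i. xopt i - m i) = - edot d (G m) (\<lambda>i. x i - m i)"
    unfolding edot_def sum_negf [symmetric] m_def
    by (intro sum.cong) (auto simp: field_simps)
  show ?thesis
    using lower[OF m x] lower[OF m xopt_in] gap_nonneg[OF m] unfolding e g by simp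
qed

text \<open>\<open>tangent\<close> and \<open>upper\<close> enclose the increment of
  \<open>f\<close> between its linear part and that part plus \<open>\<beta> * h\<^sup>2\<close>;
  division by \<open>h\<close> gives the bound.\<close>

lemma finite_difference_error:
  assumes x: "x \<in> topspace (Euclidean_space d)" and "i < d" "h > 0"
  shows "\<bar>G x i - (f (\<lambda>j. x j + (if j = i then h else 0)) - f x) / h\<bar> \<le> \<beta> * h"
proof -
  let ?y = "\<lambda>j. x j + (if j = i then h else 0)"
  have y: "?y \<in> topspace (Euclidean_space d)"
    using x \<open>i < d\<close> by (auto simp: topspace_Euclidean_space)
  have "edot d (G x) (\<lambda>j. ?y j - x j) = (\<Sum>j<d. if j = i then G x i * h else 0)"
    unfolding edot_def by (intro sum.cong) auto
  then have g: "edot d (G x) (\<lambda>j. ?y j - x j) = G x i * h"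
    using \<open>i < d\<close> by (simp add: sum.delta)
  have "enorm d (\<lambda>j. ?y j - x j) \<le> h"
    using enorm_single[of d i h] \<open>h > 0\<close> by simp
  then have "(enorm d (\<lambda>j. ?y j - x j))\<^sup>2 \<le> h\<^sup>2"
    by (intro power_mono enorm_nonneg)
  then have "\<beta> * (enorm d (\<lambda>j. ?y j - x j))\<^sup>2 \<le> \<beta> * h\<^sup>2"
    using beta_pos by simp
  then have "f ?y \<le> f x + G x i * h + \<beta> * h\<^sup>2"
    using upper[OF x y] unfolding g by linarith
  moreover have "f x + G x i * h \<le> f ?y"
    using tangent[OF x y] unfolding g .
  ultimately have "0 \<le> f ?y - f x - G x i * h" "f ?y - f x - G x i * h \<le> \<beta> * h * h"
    by (auto simp: power2_eq_square)
  moreover have "G x i - (f ?y - f x) / h = - ((f ?y - f x - G x i * h) / h)"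
    using \<open>h > 0\<close> by (simp add: field_simps)
  ultimately show ?thesis
    using \<open>h > 0\<close> by (simp add: pos_divide_le_eq)
qed

text \<open>\<open>upper\<close> at \<open>y\<close> leaves the quadratic term
  \<open>\<beta> * t\<^sup>2\<close> times the squared distance from \<open>z\<close> to
  \<open>p\<close>. The projection inequality contributes the same term with the opposite sign,
  which is why the step size is \<open>1 / (2 * \<beta> * t)\<close>.\<close>

lemma accelerated_step:
  assumes "r > 0" and x: "x \<in> euclid_cball d r" and z: "z \<in> euclid_cball d r"
    and opt_in: "xopt \<in> euclid_cball d r" and g0: "\<forall>i\<ge>d. g i = 0"
    and t: "0 < t" "t \<le> 1"
    and y_def: "y = (\<lambda>i. (1 - t) * x i + t * z i)"
    and p_def: "p = ball_proj d r (\<lambda>i. z i - g i / (2 * \<beta> * t))"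
    and x'_def: "x' = (\<lambda>i. (1 - t) * x i + t * p i)"
    and err: "edot d (\<lambda>i. G y i - g i) (\<lambda>i. p i - xopt i) \<le> \<eta>"
  shows "f x' - f xopt \<le> (1 - t) * (f x - f xopt)
      + \<beta> * t\<^sup>2 * ((enorm d (\<lambda>i. z i - xopt i))\<^sup>2 - (enorm d (\<lambda>i. p i - xopt i))\<^sup>2) + t * \<eta>"
proof -
  have p: "p \<in> euclid_cball d r"
    unfolding p_def using z g0 \<open>r > 0\<close> by (intro ball_proj_in) (auto simp: euclid_cball_iff)
  have y: "y \<in> euclid_cball d r" "x' \<in> euclid_cball d r"
    unfolding y_def x'_def using x z p t by (auto intro!: euclid_cball_convex)
  note top = y[unfolded euclid_cball_def] x[unfolded euclid_cball_def] xopt_in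
  have "f x' \<le> f y + edot d (G y) (\<lambda>i. x' i - y i) + \<beta> * (enorm d (\<lambda>i. x' i - y i))\<^sup>2"
    using upper top by blast
  moreover have "(enorm d (\<lambda>i. x' i - y i))\<^sup>2 = t\<^sup>2 * (enorm d (\<lambda>i. p i - z i))\<^sup>2"
    unfolding enorm_sq sum_distrib_left x'_def y_def
    by (intro sum.cong) (auto simp: power2_eq_square algebra_simps)
  \<comment> \<open>The displacement is split as
    \<open>(1 - t) * (x - y) + t * (xopt - y) + t * (p - xopt)\<close>. Tangents at \<open>y\<close>
    handle the first two parts; in the third, \<open>G y\<close> is exchanged for the computed
    \<open>g\<close>.\<close>
  moreover have "edot d (G y) (\<lambda>i. x' i - y i) =
      (1 - t) * edot d (G y) (\<lambda>i. x i - y i) + t * edot d (G y) (\<lambda>i. xopt i - y i)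
      + t * edot d (\<lambda>i. G y i - g i) (\<lambda>i. p i - xopt i) + t * edot d g (\<lambda>i. p i - xopt i)"
    unfolding edot_def sum_distrib_left sum.distrib [symmetric] x'_def
    by (intro sum.cong) (auto simp: algebra_simps)
  moreover have "(1 - t) * edot d (G y) (\<lambda>i. x i - y i) \<le> (1 - t) * (f x - f y)"
    using tangent[of y x] top t by (intro mult_left_mono) auto
  moreover have "t * edot d (G y) (\<lambda>i. xopt i - y i) \<le> t * (f xopt - f y)"
    using tangent[of y xopt] top t by (intro mult_left_mono) auto
  moreover have "t * edot d (\<lambda>i. G y i - g i) (\<lambda>i. p i - xopt i) \<le> t * \<eta>"
    using err t by simp
  moreover have "t * edot d g (\<lambda>i. p i - xopt i) \<le> \<beta> * t\<^sup>2 *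
      ((enorm d (\<lambda>i. z i - xopt i))\<^sup>2 - (enorm d (\<lambda>i. p i - xopt i))\<^sup>2 - (enorm d (\<lambda>i. p i - z i))\<^sup>2)"
  proof -
    have "0 \<le> edot d (\<lambda>i. p i - (z i - g i / (2 * \<beta> * t))) (\<lambda>i. xopt i - p i)"
      unfolding p_def using ball_proj_variational[OF \<open>r > 0\<close> opt_in] .
    also have "\<dots> = edot d (\<lambda>i. p i - z i) (\<lambda>i. xopt i - p i)
        - edot d g (\<lambda>i. p i - xopt i) / (2 * \<beta> * t)"
      unfolding edot_def sum_divide_distrib sum_subtractf [symmetric]
      using t beta_pos by (intro sum.cong) (auto simp: field_simps)
    finally have "edot d g (\<lambda>i. p i - xopt i) / (2 * \<beta> * t) \<le> edot d (\<lambda>i. p i - z i) (\<lambda>i. xopt i - p i)"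
      by simp
    then have "edot d g (\<lambda>i. p i - xopt i) \<le> 2 * \<beta> * t * edot d (\<lambda>i. p i - z i) (\<lambda>i. xopt i - p i)"
      using t beta_pos by (simp add: field_simps)
    then have "t * edot d g (\<lambda>i. p i - xopt i)
        \<le> t * (2 * \<beta> * t * edot d (\<lambda>i. p i - z i) (\<lambda>i. xopt i - p i))"
      using t by simp
    then show ?thesis
      unfolding edot_three_points by (simp add: power2_eq_square algebra_simps)
  qed
  ultimately show ?thesis
    by (simp add: algebra_simps)
qed

end

subsection \<open>The restarted accelerated method\<close>

text \<open>Step \<open>k\<close> uses the \<open>d + 1\<close> values \<open>v (k * Suc d), \<dots>, v (k * Suc d + d)\<close>: one at the
  extrapolated point and one at each of its coordinate perturbations. Every \<open>n\<close> steps the momentum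
  is reset. The algorithm only looks at the values, since it can reconstruct the queries.\<close>

locale restarted_method =
  fixes d n :: nat and R \<beta> h :: real
  assumes n_pos: "n > 0" and R_pos: "R > 0" and h_pos: "h > 0" and h_le: "h \<le> R / 2"
begin

text \<open>The classical weights \<open>2 / (s + 2)\<close>, with \<open>s\<close> counted from the
  last restart. The weight is 1 at \<open>s = 0\<close>, so a new stage forgets the previous
  gap.\<close>

definition weight :: "nat \<Rightarrow> real" where
  "weight k = 2 / (real (k mod n) + 2)"

definition fd_gradient :: "(nat \<Rightarrow> real) \<Rightarrow> nat \<Rightarrow> (nat \<Rightarrow> real)" where
  "fd_gradient v k = (\<lambda>i. if i < d then (v (k * Suc d + Suc i) - v (k * Suc d)) / h else 0)"

text \<open>The point \<open>z\<close> of the method. At the start of a stage the current iterate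
  takes its place; this is the restart.\<close>

definition anchor :: "nat \<Rightarrow> (nat \<Rightarrow> real) \<times> (nat \<Rightarrow> real) \<Rightarrow> (nat \<Rightarrow> real)" where
  "anchor k s = (if k mod n = 0 then fst s else snd s)"

definition proj_step :: "(nat \<Rightarrow> real) \<Rightarrow> nat \<Rightarrow> (nat \<Rightarrow> real) \<Rightarrow> (nat \<Rightarrow> real)" where
  "proj_step v k z = ball_proj d (R / 2) (\<lambda>i. z i - fd_gradient v k i / (2 * \<beta> * weight k))"

text \<open>The recursion is driven by a bare sequence \<open>v\<close> of values, so that the
  algorithm (values from a finite history) and the analysis (all responses) share it. The first
  component is the iterate, the second the projected point.\<close>

primrec state :: "(nat \<Rightarrow> real) \<Rightarrow> nat \<Rightarrow> (nat \<Rightarrow> real) \<times> (nat \<Rightarrow> real)" where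
  "state v 0 = (\<lambda>_. 0, \<lambda>_. 0)"
| "state v (Suc k) =
    (let z = proj_step v k (anchor k (state v k))
     in (\<lambda>i. (1 - weight k) * fst (state v k) i + weight k * z i, z))"

definition extrapolation :: "(nat \<Rightarrow> real) \<Rightarrow> nat \<Rightarrow> (nat \<Rightarrow> real)" where
  "extrapolation v k =
    (\<lambda>i. (1 - weight k) * fst (state v k) i + weight k * anchor k (state v k) i)"

definition query :: "(nat \<Rightarrow> real) \<Rightarrow> nat \<Rightarrow> (nat \<Rightarrow> real)" where
  "query v t =
    (\<lambda>i. extrapolation v (t div Suc d) i + (if t mod Suc d = Suc i then h else 0))"

definition observed :: "(nat \<Rightarrow> (nat \<Rightarrow> real) \<times> real) \<Rightarrow> nat \<Rightarrow> real" where
  "observed H = (\<lambda>j. snd (H j))"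

definition oracle_query :: "nat \<Rightarrow> (nat \<Rightarrow> (nat \<Rightarrow> real) \<times> real) \<Rightarrow> (nat \<Rightarrow> real)" where
  "oracle_query t H = query (observed H) t"

definition final_point :: "nat \<Rightarrow> (nat \<Rightarrow> (nat \<Rightarrow> real) \<times> real) \<Rightarrow> (nat \<Rightarrow> real)" where
  "final_point k H = fst (state (observed H) k)"

lemma weight_bounds: "0 < weight k" "weight k \<le> 1"
  by (auto simp: weight_def)

lemma zero_in_ball: "(\<lambda>_. 0) \<in> euclid_cball d (R / 2)"
  using R_pos by (simp add: euclid_cball_iff enorm_def L2_set_def)

lemma state_in_ball:
  "fst (state v k) \<in> euclid_cball d (R / 2) \<and> snd (state v k) \<in> euclid_cball d (R / 2)"
proof (induction k)
  case 0
  then show ?case using zero_in_ball by simp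
next
  case (Suc k)
  then have "anchor k (state v k) \<in> euclid_cball d (R / 2)" by (simp add: anchor_def)
  then have "proj_step v k (anchor k (state v k)) \<in> euclid_cball d (R / 2)"
    unfolding proj_step_def using R_pos
    by (intro ball_proj_in) (auto simp: euclid_cball_iff fd_gradient_def)
  then show ?case
    using Suc weight_bounds[of k] by (auto simp: Let_def intro!: euclid_cball_convex)
qed

lemma anchor_in_ball: "anchor k (state v k) \<in> euclid_cball d (R / 2)"
  using state_in_ball by (simp add: anchor_def)

lemma extrapolation_in_ball: "extrapolation v k \<in> euclid_cball d (R / 2)"
  unfolding extrapolation_def using state_in_ball anchor_in_ball weight_bounds[of k]
  by (intro euclid_cball_convex) auto

lemma query_in_ball: "query v t \<in> euclid_cball d R"
proof -
  define k where "k = t div Suc d"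
  have y: "extrapolation v k \<in> euclid_cball d (R / 2)" by (rule extrapolation_in_ball)
  \<comment> \<open>At remainder 0 the query is unperturbed, while the truncated predecessor also
    points to coordinate 0; hence the increment must be set to 0 there.\<close>
  have p: "(\<lambda>i. if t mod Suc d = Suc i then h else 0) = (\<lambda>i. if i = t mod Suc d - 1 then
      (if t mod Suc d = 0 then 0 else h) else 0)" by auto
  have "enorm d (\<lambda>i. if t mod Suc d = Suc i then h else 0) \<le> h"
    unfolding p using enorm_single[of d "t mod Suc d - 1" "if t mod Suc d = 0 then 0 else h"] h_pos
    by (auto split: if_splits)
  then have "enorm d (query v t) \<le> R"
    unfolding query_def k_def [symmetric]
    using enorm_triangle[of d "extrapolation v k" "\<lambda>i. if t mod Suc d = Suc i then h else 0"] y h_le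
    by (auto simp: euclid_cball_iff)
  moreover have "query v t i = 0" if "i \<ge> d" for i
  proof -
    have "t mod Suc d < Suc d" by simp
    then have "t mod Suc d \<noteq> Suc i" using that by linarith
    then show ?thesis
      using y that unfolding query_def k_def [symmetric] by (simp add: euclid_cball_iff)
  qed
  ultimately show ?thesis by (simp add: euclid_cball_iff)
qed

section \<open>Causality: states and queries depend on earlier values only\<close>

lemma state_cong:
  assumes "\<And>j. j < k * Suc d \<Longrightarrow> v j = w j"
  shows "state v k = state w k"
  using assms
proof (induction k)
  case (Suc k)
  then have "state v k = state w k" by simp
  moreover have "fd_gradient v k = fd_gradient w k"
    using Suc.prems by (auto simp: fd_gradient_def)
  ultimately show ?case by (simp add: proj_step_def)
qed simp

text \<open>All queries of one block are fixed once the preceding blocks are answered, and those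
  contain only indices below \<open>t\<close>.\<close>

lemma query_cong:
  assumes "\<And>j. j < t \<Longrightarrow> v j = w j"
  shows "query v t = query w t"
proof -
  have "t div Suc d * Suc d \<le> t" by (rule div_times_less_eq_dividend)
  then have "state v (t div Suc d) = state w (t div Suc d)"
    using assms by (intro state_cong) auto
  then show ?thesis by (simp add: query_def extrapolation_def)
qed

subsection \<open>Measurability\<close>

lemma observed_measurable:
  "(\<lambda>H. observed H j) \<in> borel_measurable (history_space d R t)"
proof (cases "j < t")
  case True
  then have "(\<lambda>H. H j) \<in> measurable (history_space d R t) (query_space d R \<Otimes>\<^sub>M borel)"
    unfolding history_space_def by (intro measurable_component_singleton) simp
  then show ?thesis
    unfolding observed_def by (rule measurable_compose[OF _ measurable_snd])
next
  case False
  \<comment> \<open>Histories are extensional, so entries beyond their length are the constant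
    \<open>undefined\<close>. This gives measurability for every index, as
    \<open>state_measurable\<close> requires.\<close>
  then have "observed H j = snd (undefined :: (nat \<Rightarrow> real) \<times> real)"
    if "H \<in> space (history_space d R t)" for H
    using that by (auto simp: observed_def history_space_def space_PiM PiE_def extensional_def)
  then show ?thesis
    by (subst measurable_cong) auto
qed

lemma ball_proj_measurable:
  assumes "\<And>i. (\<lambda>H. u H i) \<in> borel_measurable M"
  shows "(\<lambda>H. ball_proj d r (u H) i) \<in> borel_measurable M"
  unfolding ball_proj_def enorm_def L2_set_def using assms by measurable

lemma anchor_measurable:
  assumes "(\<lambda>H. fst (s H) i) \<in> borel_measurable M" "(\<lambda>H. snd (s H) i) \<in> borel_measurable M"
  shows "(\<lambda>H. anchor k (s H) i) \<in> borel_measurable M"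
  using assms by (cases "k mod n = 0") (simp_all add: anchor_def)

lemma state_measurable:
  assumes v: "\<And>j. (\<lambda>H. v H j) \<in> borel_measurable M"
  shows "(\<lambda>H. fst (state (v H) k) i) \<in> borel_measurable M
    \<and> (\<lambda>H. snd (state (v H) k) i) \<in> borel_measurable M"
proof (induction k arbitrary: i)
  case (Suc k)
  have a: "(\<lambda>H. anchor k (state (v H) k) i) \<in> borel_measurable M" for i
    using Suc[of i] by (intro anchor_measurable) auto
  have g: "(\<lambda>H. fd_gradient (v H) k i) \<in> borel_measurable M" for i
    unfolding fd_gradient_def using v by measurable
  have p: "(\<lambda>H. proj_step (v H) k (anchor k (state (v H) k)) i) \<in> borel_measurable M" for i
    unfolding proj_step_def by (intro ball_proj_measurable borel_measurable_diff borel_measurable_divide a g) simp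
  show ?case
    using Suc[of i] p[of i] by (auto simp: Let_def)
qed simp

lemma oracle_query_measurable:
  "oracle_query t \<in> measurable (history_space d R t) (query_space d R)"
proof -
  have s: "(\<lambda>H. fst (state (observed H) k) i) \<in> borel_measurable (history_space d R t)"
    "(\<lambda>H. snd (state (observed H) k) i) \<in> borel_measurable (history_space d R t)" for k i
    using state_measurable[OF observed_measurable] by auto
  have "(\<lambda>H. query (observed H) t i) \<in> borel_measurable (history_space d R t)" for i
    unfolding query_def extrapolation_def
    by (intro borel_measurable_add borel_measurable_times anchor_measurable s) auto
  then have "(\<lambda>H. query (observed H) t) \<in> borel_measurable (history_space d R t)"
    by (intro measurable_coordinatewise_then_product) simp
  then show ?thesis
    unfolding query_space_def oracle_query_def
    by (intro measurable_restrict_space2) (auto simp: query_in_ball)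
qed

lemma final_point_in_ball: "final_point k H \<in> euclid_cball d (R / 2)"
  unfolding final_point_def using state_in_ball by blast

lemma final_point_measurable:
  "final_point k \<in> measurable (history_space d R t) (query_space d R)"
proof -
  have "(\<lambda>H. fst (state (observed H) k) i) \<in> borel_measurable (history_space d R t)" for i
    using state_measurable[OF observed_measurable] by auto
  then have "(\<lambda>H. fst (state (observed H) k)) \<in> borel_measurable (history_space d R t)"
    by (intro measurable_coordinatewise_then_product) simp
  moreover have "final_point k H \<in> euclid_cball d R" for H
    using final_point_in_ball[of k H] R_pos by (simp add: euclid_cball_iff)
  ultimately show ?thesis
    unfolding query_space_def by (intro measurable_restrict_space2) (auto simp: final_point_def [abs_def])
qed

lemma method_is_algorithm: "is_algorithm d R T oracle_query (final_point k)"
  unfolding is_algorithm_def using oracle_query_measurable final_point_measurable by blast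

subsection \<open>Convergence\<close>

text \<open>The infinite stream of oracle answers, independent of any budget. Entry \<open>j\<close>
  is read from the first transcript that contains it.\<close>

definition response :: "((nat \<Rightarrow> real) \<Rightarrow> real) \<Rightarrow> nat \<Rightarrow> real" where
  "response f j = snd (transcript oracle_query f (Suc j) j)"

lemma observed_transcript:
  "j < t \<Longrightarrow> observed (transcript oracle_query f t) j = response f j"
proof (induction t)
  case (Suc t)
  then show ?case
    by (cases "j = t") (auto simp: observed_def response_def Let_def)
qed simp

text \<open>Causality makes the stream self-consistent: each answer is the value of \<open>f\<close>
  at the query computed from the stream itself. The convergence analysis can thus work without
  transcripts.\<close>

lemma response_eq: "response f t = f (query (response f) t)"
proof -
  have "query (observed (transcript oracle_query f t)) t = query (response f) t"
    by (intro query_cong observed_transcript)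
  then show ?thesis by (simp add: response_def Let_def oracle_query_def)
qed

lemma final_point_transcript:
  "final_point k (transcript oracle_query f (k * Suc d)) = fst (state (response f) k)"
proof -
  have "state (observed (transcript oracle_query f (k * Suc d))) k = state (response f) k"
    by (intro state_cong observed_transcript)
  then show ?thesis by (simp only: final_point_def)
qed

end

section \<open>Gap and distance bounds along a run on a fixed objective\<close>

locale restarted_run = restarted_method d n R \<beta> h + smooth_convex d \<mu> \<beta> f G xopt
  for d n R \<beta> h \<mu> f G xopt +
  assumes xopt_ball: "xopt \<in> euclid_cball d (R / 2)"
begin

definition iterate :: "nat \<Rightarrow> (nat \<Rightarrow> real)" where
  "iterate k = fst (state (response f) k)"

text \<open>Coordinatewise bound for the gradient error paired with a displacement: \<open>d\<close>
  terms, each with gradient error at most \<open>\<beta> * h\<close> and displacement at most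
  \<open>R\<close>. The factor \<open>d\<close> is harmless, since \<open>h\<close> is free.\<close>

definition error :: real where
  "error = real d * (\<beta> * h * R)"

lemma error_nonneg: "0 \<le> error"
  using beta_pos h_pos R_pos by (simp add: error_def)

lemma iterate_ball: "iterate k \<in> euclid_cball d (R / 2)"
  using state_in_ball by (simp add: iterate_def)

lemma iterate_top: "iterate k \<in> topspace (Euclidean_space d)"
  using iterate_ball by (simp add: euclid_cball_def)

lemma dist_xopt_le:
  assumes "p \<in> euclid_cball d (R / 2)"
  shows "enorm d (\<lambda>i. p i - xopt i) \<le> R"
  using enorm_diff_le[of d p xopt] assms xopt_ball by (simp add: euclid_cball_iff)

lemma fd_gradient_error:
  assumes "i < d"
  shows "\<bar>G (extrapolation (response f) k) i - fd_gradient (response f) k i\<bar> \<le> \<beta> * h"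
proof -
  let ?y = "extrapolation (response f) k"
  have y: "?y \<in> topspace (Euclidean_space d)"
    using extrapolation_in_ball by (simp add: euclid_cball_def)
  have "query (response f) (k * Suc d) = ?y"
    by (simp add: query_def del: mult_Suc_right)
  \<comment> \<open>The remainder \<open>Suc i\<close> stays below \<open>Suc d\<close> because
    \<open>i < d\<close>, so this query lies in block \<open>k\<close> and perturbs coordinate
    \<open>i\<close>.\<close>
  moreover have "(k * Suc d + Suc i) div Suc d = k" "(k * Suc d + Suc i) mod Suc d = Suc i"
    using assms by (simp_all only: div_mult_self3 mod_mult_self3 div_less mod_less Suc_less_eq)
  then have "query (response f) (k * Suc d + Suc i) = (\<lambda>j. ?y j + (if j = i then h else 0))"
    by (auto simp: query_def simp del: mult_Suc_right)
  ultimately have "fd_gradient (response f) k i = (f (\<lambda>j. ?y j + (if j = i then h else 0)) - f ?y) / h"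
    unfolding fd_gradient_def using assms response_eq by (metis (no_types, lifting))
  then show ?thesis
    using finite_difference_error[OF y assms h_pos] by simp
qed

lemma fd_gradient_edot_error:
  assumes "p \<in> euclid_cball d (R / 2)"
  shows "edot d (\<lambda>i. G (extrapolation (response f) k) i - fd_gradient (response f) k i)
      (\<lambda>i. p i - xopt i) \<le> error"
proof -
  have "edot d (\<lambda>i. G (extrapolation (response f) k) i - fd_gradient (response f) k i)
      (\<lambda>i. p i - xopt i) \<le> (\<Sum>i<d. \<beta> * h * R)"
    unfolding edot_def
  proof (intro sum_mono)
    fix i assume "i \<in> {..<d}"
    then have i: "i < d" by simp
    have "\<bar>p i - xopt i\<bar> \<le> R"
      using abs_component_le_enorm[OF i, of "\<lambda>i. p i - xopt i"] dist_xopt_le[OF assms] by linarith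
    then have "\<bar>G (extrapolation (response f) k) i - fd_gradient (response f) k i\<bar> * \<bar>p i - xopt i\<bar>
        \<le> \<beta> * h * R"
      using fd_gradient_error[OF i] beta_pos h_pos by (intro mult_mono) auto
    then show "(G (extrapolation (response f) k) i - fd_gradient (response f) k i) * (p i - xopt i)
        \<le> \<beta> * h * R"
      by (metis abs_ge_self abs_mult order_trans)
  qed
  then show ?thesis by (simp add: error_def)
qed

lemma run_step:
  fixes k
  defines "z \<equiv> anchor k (state (response f) k)" and "p \<equiv> snd (state (response f) (Suc k))"
  shows "f (iterate (Suc k)) - f xopt \<le> (1 - weight k) * (f (iterate k) - f xopt)
      + \<beta> * (weight k)\<^sup>2 * ((enorm d (\<lambda>i. z i - xopt i))\<^sup>2 - (enorm d (\<lambda>i. p i - xopt i))\<^sup>2)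
      + weight k * error"
proof (rule accelerated_step)
  show "p = ball_proj d (R / 2) (\<lambda>i. z i - fd_gradient (response f) k i / (2 * \<beta> * weight k))"
    by (simp add: p_def z_def Let_def proj_step_def)
  show "iterate (Suc k) = (\<lambda>i. (1 - weight k) * iterate k i + weight k * p i)"
    by (simp add: iterate_def p_def Let_def)
  show "edot d (\<lambda>i. G (extrapolation (response f) k) i - fd_gradient (response f) k i)
      (\<lambda>i. p i - xopt i) \<le> error"
    unfolding p_def using state_in_ball by (intro fd_gradient_edot_error) blast
  show "extrapolation (response f) k = (\<lambda>i. (1 - weight k) * iterate k i + weight k * z i)"
    by (simp add: extrapolation_def iterate_def z_def)
qed (use R_pos iterate_ball anchor_in_ball xopt_ball weight_bounds in
      \<open>auto simp: z_def fd_gradient_def\<close>)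

text \<open>The potential \<open>s (s + 2) / 4 \<cdot> gap + \<beta> \<cdot> distance\<^sup>2\<close> grows by at most
  \<open>(s + 2) / 2 \<cdot> error\<close> at step \<open>s\<close> of a stage.\<close>

lemma stage_potential:
  assumes "0 < s" "s \<le> n"
  shows "real s * (real s + 2) / 4 * (f (iterate (j * n + s)) - f xopt)
      + \<beta> * (enorm d (\<lambda>i. snd (state (response f) (j * n + s)) i - xopt i))\<^sup>2
    \<le> \<beta> * (enorm d (\<lambda>i. iterate (j * n) i - xopt i))\<^sup>2 + real s * (real n + 2) / 2 * error"
    (is "?P s \<le> ?D + _")
proof -
  \<comment> \<open>At \<open>s = 0\<close> the anchor is the iterate, not the second component of
    the state, so the distance needs a separate first value.\<close>
  define Z where "Z s = (if s = 0 then (enorm d (\<lambda>i. iterate (j * n) i - xopt i))\<^sup>2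
    else (enorm d (\<lambda>i. snd (state (response f) (j * n + s)) i - xopt i))\<^sup>2)" for s
  have "s \<le> n \<Longrightarrow> real s * (real s + 2) / 4 * (f (iterate (j * n + s)) - f xopt) + \<beta> * Z s
      \<le> ?D + real s * (real n + 2) / 2 * error" for s
  proof (induction s)
    case 0
    then show ?case by (simp add: Z_def)
  next
    case (Suc s)
    define k where "k = j * n + s"
    define c where "c = real s + 2"
    have c: "c \<ge> 2" "c \<le> real n + 2" using Suc.prems by (auto simp: c_def)
    have m: "k mod n = s" using Suc.prems by (simp add: k_def)
    then have w: "weight k = 2 / c" by (simp add: weight_def c_def)
    define a where "a = f (iterate k) - f xopt"
    define b where "b = f (iterate (Suc k)) - f xopt"
    have b: "0 \<le> b" unfolding b_def by (rule gap_nonneg[OF iterate_top])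
    have z: "(enorm d (\<lambda>i. anchor k (state (response f) k) i - xopt i))\<^sup>2 = Z s"
      using m by (auto simp: anchor_def Z_def k_def iterate_def)
    have z': "(enorm d (\<lambda>i. snd (state (response f) (Suc k)) i - xopt i))\<^sup>2 = Z (Suc s)"
      by (simp add: Z_def k_def)
    have "b \<le> (1 - 2 / c) * a + \<beta> * (2 / c)\<^sup>2 * (Z s - Z (Suc s)) + 2 / c * error"
      using run_step[of k] unfolding z z' w a_def b_def .
    \<comment> \<open>The factor \<open>c\<^sup>2 / 4\<close> is the inverse square of the weight,
      so the distance terms get coefficient \<open>\<beta>\<close> and telescope.\<close>
    then have "c\<^sup>2 / 4 * b \<le> c\<^sup>2 / 4 * ((1 - 2 / c) * a + \<beta> * (2 / c)\<^sup>2 * (Z s - Z (Suc s)) + 2 / c * error)"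
      by (intro mult_left_mono) auto
    also have "\<dots> = (c - 2) * c / 4 * a + \<beta> * (Z s - Z (Suc s)) + c / 2 * error"
      using c by (simp add: field_simps power2_eq_square)
    finally have main: "c\<^sup>2 / 4 * b + \<beta> * Z (Suc s) \<le> (c - 2) * c / 4 * a + \<beta> * Z s + c / 2 * error"
      by (simp add: algebra_simps)
    \<comment> \<open>The next coefficient \<open>(s + 1) * (s + 3) / 4\<close> is slightly below
      \<open>c\<^sup>2 / 4\<close>; nonnegativity of the gap permits the exchange.\<close>
    have "(c - 1) * (c + 1) / 4 * b \<le> c\<^sup>2 / 4 * b"
      using b by (intro mult_right_mono) (auto simp: power2_eq_square algebra_simps)
    moreover have "c / 2 * error \<le> (real n + 2) / 2 * error"
      using c error_nonneg by (intro mult_right_mono) auto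
    moreover have "(c - 2) * c / 4 * a + \<beta> * Z s \<le> ?D + real s * (real n + 2) / 2 * error"
      using Suc by (simp add: c_def a_def k_def)
    ultimately have "(c - 1) * (c + 1) / 4 * b + \<beta> * Z (Suc s)
        \<le> ?D + real s * (real n + 2) / 2 * error + (real n + 2) / 2 * error"
      using main by linarith
    then show ?case
      by (simp add: c_def b_def k_def algebra_simps add_divide_distrib)
  qed
  from this[OF assms(2)] show ?thesis using assms(1) by (simp add: Z_def)
qed

text \<open>The potential at the end of a stage, without its distance term, divided by
  \<open>n * (n + 2) / 4\<close>.\<close>

lemma stage_gap:
  "f (iterate (Suc j * n)) - f xopt
    \<le> 4 * \<beta> / (real n)\<^sup>2 * (enorm d (\<lambda>i. iterate (j * n) i - xopt i))\<^sup>2 + 2 * error"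
proof -
  define a where "a = f (iterate (Suc j * n)) - f xopt"
  define D where "D = (enorm d (\<lambda>i. iterate (j * n) i - xopt i))\<^sup>2"
  define N where "N = real n"
  have N: "N > 0" using n_pos by (simp add: N_def)
  have "0 \<le> \<beta> * D" using beta_pos by (simp add: D_def)
  have "N * (N + 2) / 4 * a \<le> \<beta> * D + N * (N + 2) / 2 * error"
  proof -
    have "0 \<le> \<beta> * (enorm d (\<lambda>i. snd (state (response f) (j * n + n)) i - xopt i))\<^sup>2"
      using beta_pos by simp
    moreover have "Suc j * n = j * n + n" by simp
    ultimately show ?thesis
      using stage_potential[OF n_pos order_refl, of j] unfolding a_def D_def N_def by (simp only:)
  qed
  moreover have "a \<le> 4 * b / c + 2 * e" if "c / 4 * a \<le> b + c / 2 * e" "c > 0" for b c e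
    using that by (simp add: field_simps)
  ultimately have "a \<le> 4 * (\<beta> * D) / (N * (N + 2)) + 2 * error"
    using N by simp
  also have "4 * (\<beta> * D) / (N * (N + 2)) \<le> 4 * (\<beta> * D) / N\<^sup>2"
    using N \<open>0 \<le> \<beta> * D\<close> by (intro divide_left_mono) (auto simp: power2_eq_square)
  finally show ?thesis by (simp add: a_def D_def N_def)
qed

text \<open>Quadratic growth turns the gap after a stage into a distance: for
  \<open>n\<^sup>2\<close> at least \<open>64 * \<beta> / \<mu>\<close> the squared distance drops
  by the factor 4, up to \<open>8 * error / \<mu>\<close>. The constant 16 is preserved because 16 /
  4 + 8 is at most 16. The case \<open>j = 0\<close> admits a single stage of any length.\<close>

lemma stage_distance:
  assumes "j = 0 \<or> 64 * \<beta> / \<mu> \<le> (real n)\<^sup>2"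
  shows "(enorm d (\<lambda>i. iterate (j * n) i - xopt i))\<^sup>2 \<le> R\<^sup>2 / 4 ^ j + 16 * error / \<mu>"
  using assms
proof (induction j)
  case 0
  have "(enorm d (\<lambda>i. iterate 0 i - xopt i))\<^sup>2 \<le> R\<^sup>2"
    using dist_xopt_le[OF iterate_ball] by (intro power_mono enorm_nonneg)
  moreover have "0 \<le> 16 * error / \<mu>" using error_nonneg mu_pos by simp
  ultimately show ?case unfolding mult_0 power_0 div_by_1 by linarith
next
  case (Suc j)
  then have n: "64 * \<beta> / \<mu> \<le> (real n)\<^sup>2" by simp
  define D where "D j = (enorm d (\<lambda>i. iterate (j * n) i - xopt i))\<^sup>2" for j
  have IH: "D j \<le> R\<^sup>2 / 4 ^ j + 16 * error / \<mu>" using Suc.IH n by (simp add: D_def)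
  have "\<mu> / 4 * D (Suc j) \<le> 4 * \<beta> / (real n)\<^sup>2 * D j + 2 * error"
    using quadratic_growth[OF iterate_top] stage_gap[of j] unfolding D_def by (rule order_trans)
  also have "4 * \<beta> / (real n)\<^sup>2 * D j \<le> \<mu> / 16 * D j"
    using n n_pos mu_pos by (intro mult_right_mono) (auto simp: D_def field_simps)
  finally have "D (Suc j) \<le> D j / 4 + 8 * (error / \<mu>)"
    using mu_pos by (simp add: field_simps)
  moreover have "0 \<le> error / \<mu>" using error_nonneg mu_pos by simp
  ultimately have "D (Suc j) \<le> R\<^sup>2 / 4 ^ Suc j + 16 * error / \<mu>"
    using IH by simp
  then show ?case by (simp only: D_def)
qed

text \<open>The first \<open>j\<close> stages shrink the distance; the last one converts it into a
  gap.\<close>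

lemma run_gap:
  assumes "j = 0 \<or> 64 * \<beta> / \<mu> \<le> (real n)\<^sup>2"
  shows "f (iterate (Suc j * n)) - f xopt
    \<le> 4 * \<beta> * R\<^sup>2 / ((real n)\<^sup>2 * 4 ^ j) + (64 * (\<beta> / \<mu>) + 2) * error"
proof -
  have N: "1 \<le> (real n)\<^sup>2" using n_pos by simp
  have "f (iterate (Suc j * n)) - f xopt
      \<le> 4 * \<beta> / (real n)\<^sup>2 * (R\<^sup>2 / 4 ^ j + 16 * error / \<mu>) + 2 * error"
    using stage_gap[of j] mult_left_mono[OF stage_distance[OF assms], of "4 * \<beta> / (real n)\<^sup>2"] beta_pos
    by simp
  also have "\<dots> = 4 * \<beta> * R\<^sup>2 / ((real n)\<^sup>2 * 4 ^ j) + 64 * (\<beta> / \<mu>) * error / (real n)\<^sup>2 + 2 * error"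
    by (simp add: distrib_left mult.commute)
  also have "64 * (\<beta> / \<mu>) * error / (real n)\<^sup>2 \<le> 64 * (\<beta> / \<mu>) * error"
    using divide_left_mono[OF N, of "64 * (\<beta> / \<mu>) * error"] error_nonneg beta_pos mu_pos n_pos by simp
  finally show ?thesis by (simp add: distrib_right)
qed

end

section \<open>Choice of parameters and the complexity bound\<close>

lemma restarted_method_complexity:
  fixes d n j :: nat and R \<mu> \<beta> \<epsilon> :: real
  assumes "d \<ge> 1" "R > 0" "0 < \<mu>" "\<mu> \<le> \<beta>" "0 < \<epsilon>" "n > 0"
    and restart: "j = 0 \<or> 64 * \<beta> / \<mu> \<le> (real n)\<^sup>2"
    and steps: "8 * \<beta> * R\<^sup>2 / \<epsilon> \<le> (real n)\<^sup>2 * 4 ^ j"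
  shows "\<exists>q qout. is_algorithm d R (Suc j * n * Suc d) q qout \<and>
      worst_gap d R \<mu> \<beta> (Suc j * n * Suc d) q qout \<le> ereal \<epsilon> \<and>
      (\<forall>t H. q t H \<in> euclid_cball d R) \<and> (\<forall>H. qout H \<in> euclid_cball d (R / 2))"
proof -
  define K where "K = 64 * (\<beta> / \<mu>) + 2"
  \<comment> \<open>\<open>K\<close> is the coefficient of \<open>error\<close> in
    \<open>run_gap\<close>. The first bound on \<open>h\<close> keeps perturbed queries in the ball
    of radius \<open>R\<close>, the second makes \<open>K * error\<close> at most
    \<open>\<epsilon> / 2\<close>. The choice does not depend on the objective.\<close>
  define h where "h = min (R / 2) (\<epsilon> / (2 * (K * (real d * \<beta> * R))))"
  have beta: "\<beta> > 0" using assms by linarith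
  then have K: "K > 0" using assms by (simp add: K_def add_pos_pos)
  have dbR: "real d * \<beta> * R > 0" using assms beta by simp
  have half: "c * (\<epsilon> / (2 * c)) = \<epsilon> / 2" if "c > 0" for c :: real
    using that by simp
  have h: "0 < h" "h \<le> R / 2" using assms K dbR by (auto simp: h_def)
  interpret restarted_method d n R \<beta> h
    using assms h by unfold_locales auto
  have "f (final_point (Suc j * n) (transcript oracle_query f (Suc j * n * Suc d)))
      - f (minimizer d f) \<le> \<epsilon>" if f: "f \<in> objective_class d R \<mu> \<beta>" for f
  proof -
    have "\<exists>!x. is_minimizer d f x" using f by (simp add: objective_class_def)
    then have m: "is_minimizer d f (minimizer d f)" unfolding minimizer_def by (rule theI')
    interpret restarted_run d n R \<beta> h \<mu> f "gradient d f" "minimizer d f"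
      using f m assms beta by unfold_locales (auto simp: objective_class_def)
    have "K * error = K * (real d * \<beta> * R) * h" by (simp add: error_def)
    also have "\<dots> \<le> K * (real d * \<beta> * R) * (\<epsilon> / (2 * (K * (real d * \<beta> * R))))"
      using K dbR by (intro mult_left_mono) (auto simp: h_def)
    also have "\<dots> = \<epsilon> / 2" using half[of "K * (real d * \<beta> * R)"] K dbR by (metis mult_pos_pos)
    finally have e: "K * error \<le> \<epsilon> / 2" .
    have "0 < (real n)\<^sup>2 * 4 ^ j" using \<open>n > 0\<close> by simp
    then have "4 * \<beta> * R\<^sup>2 / ((real n)\<^sup>2 * 4 ^ j) \<le> \<epsilon> / 2"
      using steps \<open>\<epsilon> > 0\<close> by (simp add: field_simps)
    then show ?thesis
      using run_gap[OF restart] e unfolding final_point_transcript iterate_def K_def by linarith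
  qed
  then have "worst_gap d R \<mu> \<beta> (Suc j * n * Suc d) oracle_query (final_point (Suc j * n)) \<le> ereal \<epsilon>"
    unfolding worst_gap_def by (intro SUP_least) simp
  then show ?thesis
    using method_is_algorithm query_in_ball final_point_in_ball
    by (intro exI[of _ oracle_query] exI[of _ "final_point (Suc j * n)"])
      (simp add: oracle_query_def)
qed

lemma stage_lengths:
  fixes Q \<kappa> :: real
  assumes "1 \<le> Q" "1 \<le> \<kappa>"
  shows "\<exists>n j :: nat. n > 0 \<and> (j = 0 \<or> 64 * \<kappa> \<le> (real n)\<^sup>2) \<and> 8 * Q \<le> (real n)\<^sup>2 * 4 ^ j \<and>
    real (Suc j * n) \<le> 18 * min (sqrt Q) (sqrt \<kappa> * (1 + log_plus (Q / \<kappa>)))"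
proof (cases "sqrt Q \<le> sqrt \<kappa> * (1 + log_plus (Q / \<kappa>))")
  case True
  \<comment> \<open>One stage suffices: \<open>(3 * sqrt Q)\<^sup>2 = 9 * Q\<close> exceeds
    \<open>8 * Q\<close>.\<close>
  define n where "n = nat \<lceil>3 * sqrt Q\<rceil>"
  have s: "1 \<le> sqrt Q" using assms by simp
  have n: "3 * sqrt Q \<le> real n" "real n \<le> 3 * sqrt Q + 1"
    unfolding n_def using s by linarith+
  then have "(3 * sqrt Q)\<^sup>2 \<le> (real n)\<^sup>2" using s by (intro power_mono) auto
  then have "8 * Q \<le> (real n)\<^sup>2" using assms by (simp add: power_mult_distrib)
  moreover have "n > 0" using n s by (intro gr0I) simp
  moreover have "real (Suc 0 * n) \<le> 18 * min (sqrt Q) (sqrt \<kappa> * (1 + log_plus (Q / \<kappa>)))"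
    unfolding min_absorb1[OF True] mult_Suc mult_0 add_0_right using n s by linarith
  ultimately show ?thesis 
    by - (rule exI[of _ n], rule exI[of _ "0::nat"], simp only: power_0 mult_1_right simp_thms)
next
  case False
  define l where "l = log_plus (Q / \<kappa>)"
  \<comment> \<open>The factor 8 meets the restart condition \<open>64 * \<kappa>\<close>. Rounding
    up costs at most one further \<open>sqrt \<kappa>\<close>, whence 9, and \<open>Suc j\<close> is
    at most \<open>2 * (1 + l)\<close>; together they give 18.\<close>
  define n where "n = nat \<lceil>8 * sqrt \<kappa>\<rceil>"
  define j where "j = nat \<lceil>l\<rceil>"
  have l: "0 \<le> l" "ln (Q / \<kappa>) \<le> l" by (auto simp: l_def log_plus_def)
  have s: "1 \<le> sqrt \<kappa>" using assms by simp
  have n: "8 * sqrt \<kappa> \<le> real n" "real n \<le> 9 * sqrt \<kappa>"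
    unfolding n_def using s by linarith+
  have j: "l \<le> real j" "real j \<le> l + 1"
    unfolding j_def using l by linarith+
  then have j': "real (Suc j) \<le> 2 * (1 + l)" using l by simp
  have "(8 * sqrt \<kappa>)\<^sup>2 \<le> (real n)\<^sup>2" using n s by (intro power_mono) auto
  then have nk: "64 * \<kappa> \<le> (real n)\<^sup>2" using assms by (simp add: power_mult_distrib)
  have "Q / \<kappa> = exp (ln (Q / \<kappa>))" using assms by simp
  also have "\<dots> \<le> exp (real j)" using l j by simp
  also have "\<dots> = exp 1 ^ j" by (simp add: exp_of_nat_mult [symmetric])
  also have "\<dots> \<le> 4 ^ j" using exp_le by (intro power_mono) auto
  finally have "Q \<le> \<kappa> * 4 ^ j" using assms by (simp add: field_simps)
  moreover have "64 * \<kappa> * 4 ^ j \<le> (real n)\<^sup>2 * 4 ^ j" using nk by (intro mult_right_mono) auto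
  ultimately have steps: "8 * Q \<le> (real n)\<^sup>2 * 4 ^ j" using assms by linarith
  have "real (Suc j * n) = real (Suc j) * real n" by (rule of_nat_mult)
  also have "\<dots> \<le> (2 * (1 + l)) * (9 * sqrt \<kappa>)"
    using j' n l by (intro mult_mono) auto
  also have "\<dots> = 18 * (sqrt \<kappa> * (1 + l))" by simp
  finally have "real (Suc j * n) \<le> 18 * min (sqrt Q) (sqrt \<kappa> * (1 + l))"
    using False by (simp add: l_def)
  moreover have "n > 0" using n s by (intro gr0I) simp
  ultimately show ?thesis using nk steps unfolding l_def by blast
qed

theorem theorem3p4:
  shows "\<exists>C::real. C > 0 \<and>
    (\<forall>(d::nat) (R::real) (\<mu>::real) (\<beta>::real) (\<epsilon>::real).
       d \<ge> 1 \<longrightarrow> R > 0 \<longrightarrow> 0 < \<mu> \<longrightarrow> \<mu> \<le> \<beta> \<longrightarrow> 0 < \<epsilon> \<longrightarrow> \<epsilon> \<le> \<beta> * R\<^sup>2 \<longrightarrow>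
       (let Q = \<beta> * R\<^sup>2 / \<epsilon>; \<kappa> = \<beta> / \<mu>;
            B = C * real d * min (sqrt Q) (sqrt \<kappa> * (1 + log_plus (Q / \<kappa>)))
        in ereal_of_enat (complexity \<epsilon> d R \<mu> \<beta>) \<le> ereal B \<and>
           (\<exists>T q qout. real T \<le> B \<and>
              is_algorithm d R T q qout \<and>
              worst_gap d R \<mu> \<beta> T q qout \<le> ereal \<epsilon> \<and>
              (\<forall>t<T. \<forall>h\<in>space (history_space d R t). q t h \<in> euclid_cball d R) \<and>
              (\<forall>h\<in>space (history_space d R T). qout h \<in> euclid_cball d (R / 2)))))"
proof (intro exI[of _ 36] conjI allI impI)
  fix d :: nat and R \<mu> \<beta> \<epsilon> :: real
  assume A: "d \<ge> 1" "R > 0" "0 < \<mu>" "\<mu> \<le> \<beta>" "0 < \<epsilon>" "\<epsilon> \<le> \<beta> * R\<^sup>2"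
  define Q where "Q = \<beta> * R\<^sup>2 / \<epsilon>"
  define \<kappa> where "\<kappa> = \<beta> / \<mu>"
  define M where "M = min (sqrt Q) (sqrt \<kappa> * (1 + log_plus (Q / \<kappa>)))"
  have "1 \<le> Q" "1 \<le> \<kappa>" using A by (auto simp: Q_def \<kappa>_def)
  from stage_lengths[OF this] obtain n j :: nat
    where nj: "n > 0" "j = 0 \<or> 64 * \<kappa> \<le> (real n)\<^sup>2" "8 * Q \<le> (real n)\<^sup>2 * 4 ^ j"
      "real (Suc j * n) \<le> 18 * M"
    unfolding M_def by blast
  have restart: "j = 0 \<or> 64 * \<beta> / \<mu> \<le> (real n)\<^sup>2"
    using nj(2) by (simp add: \<kappa>_def)
  have steps: "8 * \<beta> * R\<^sup>2 / \<epsilon> \<le> (real n)\<^sup>2 * 4 ^ j"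
    using nj(3) by (simp add: Q_def mult.assoc)
  define T where "T = Suc j * n * Suc d"
  obtain q qout where alg: "is_algorithm d R T q qout" "worst_gap d R \<mu> \<beta> T q qout \<le> ereal \<epsilon>"
    "\<forall>t H. q t H \<in> euclid_cball d R" "\<forall>H. qout H \<in> euclid_cball d (R / 2)"
    using restarted_method_complexity[OF A(1-5) nj(1) restart steps] unfolding T_def by blast
  have "real T = real (Suc j * n) * real (Suc d)" unfolding T_def by (rule of_nat_mult)
  \<comment> \<open>Since \<open>d\<close> is at least 1, \<open>Suc d\<close> is at most
    \<open>2 * d\<close>; this doubles 18 to the final constant 36.\<close>
  also have "\<dots> \<le> (18 * M) * (2 * real d)"
  proof (rule mult_mono)
    \<comment> \<open>The sign of \<open>M\<close> is read off from its being, up to the factor 18,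
      an upper bound of a natural number.\<close>
    show "0 \<le> 18 * M" using nj by (meson of_nat_0_le_iff order_trans)
  qed (use nj A in auto)
  finally have T: "real T \<le> 36 * real d * M" by (simp add: algebra_simps)
  have "complexity \<epsilon> d R \<mu> \<beta> \<le> enat T"
    unfolding complexity_def using alg by (intro INF_lower) blast
  then have "ereal_of_enat (complexity \<epsilon> d R \<mu> \<beta>) \<le> ereal_of_enat (enat T)"
    by (simp only: ereal_of_enat_le_iff)
  also have "\<dots> \<le> ereal (36 * real d * M)" using T by simp
  finally show "let Q = \<beta> * R\<^sup>2 / \<epsilon>; \<kappa> = \<beta> / \<mu>;
            B = 36 * real d * min (sqrt Q) (sqrt \<kappa> * (1 + log_plus (Q / \<kappa>)))
        in ereal_of_enat (complexity \<epsilon> d R \<mu> \<beta>) \<le> ereal B \<and>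
           (\<exists>T q qout. real T \<le> B \<and>
              is_algorithm d R T q qout \<and>
              worst_gap d R \<mu> \<beta> T q qout \<le> ereal \<epsilon> \<and>
              (\<forall>t<T. \<forall>h\<in>space (history_space d R t). q t h \<in> euclid_cball d R) \<and>
              (\<forall>h\<in>space (history_space d R T). qout h \<in> euclid_cball d (R / 2)))"
    unfolding Let_def Q_def [symmetric] \<kappa>_def [symmetric] M_def [symmetric]
    using alg T by blast
qed simp

end
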